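(* Let $n\ge 5$ and let $T$ be an $n$-vertex tree that is isomorphic neither to the path $P_n$ nor to the star $S_n$. Then $A^*(P_n) < A^*(T) < A^*(S_n)$.
   Context: All graphs are simple and finite. For a graph $G$ with edge set $E(G)$, $d_u$ denotes the degree of the vertex $u$ in $G$. The modified Albertson index of $G$ is $A^*(G)=\sum_{uv\in E(G)} |(d_u)^2-(d_v)^2|$. $P_n$ denotes the path graph on $n$ vertices and $S_n$ denotes the star graph on $n$ vertices (one vertex of degree $n-1$ and $n-1$ vertices of degree $1$). *)

theory Defs
  imports Main
begin

datatype 'a ugraph = UGraph (vertices: "'a set") (edges: "'a set set")

definition simple_graph :: "'a ugraph \<Rightarrow> bool" where
  "simple_graph G \<longleftrightarrow>
     finite (vertices G) \<and> (\<forall>e\<in>edges G. e \<subseteq> vertices G \<and> card e = 2)"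

definition adjacent :: "'a ugraph \<Rightarrow> 'a \<Rightarrow> 'a \<Rightarrow> bool" where
  "adjacent G u v \<longleftrightarrow> {u, v} \<in> edges G"

definition degree :: "'a ugraph \<Rightarrow> 'a \<Rightarrow> nat" where
  "degree G v = card {e \<in> edges G. v \<in> e}"

definition walk :: "'a ugraph \<Rightarrow> 'a list \<Rightarrow> bool" where
  "walk G xs \<longleftrightarrow> xs \<noteq> [] \<and> set xs \<subseteq> vertices G \<and> successively (adjacent G) xs"

definition connected_graph :: "'a ugraph \<Rightarrow> bool" where
  "connected_graph G \<longleftrightarrow> vertices G \<noteq> {} \<and>
     (\<forall>u\<in>vertices G. \<forall>v\<in>vertices G. \<exists>xs. walk G xs \<and> hd xs = u \<and> last xs = v)"

(* The starting vertex is not repeated at the end of the list. *)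
definition cycle :: "'a ugraph \<Rightarrow> 'a list \<Rightarrow> bool" where
  "cycle G xs \<longleftrightarrow>
     walk G xs \<and> 3 \<le> length xs \<and> distinct xs \<and> adjacent G (last xs) (hd xs)"

definition tree_graph :: "'a ugraph \<Rightarrow> bool" where
  "tree_graph G \<longleftrightarrow> simple_graph G \<and> connected_graph G \<and> (\<nexists>xs. cycle G xs)"

definition isomorphic :: "'a ugraph \<Rightarrow> 'b ugraph \<Rightarrow> bool" where
  "isomorphic G H \<longleftrightarrow> (\<exists>f. bij_betw f (vertices G) (vertices H) \<and>
     (\<forall>u\<in>vertices G. \<forall>v\<in>vertices G. adjacent G u v \<longleftrightarrow> adjacent H (f u) (f v)))"

definition path_graph :: "nat \<Rightarrow> nat ugraph" where
  "path_graph n = UGraph {..<n} {{i, Suc i} | i. Suc i < n}"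

definition star_graph :: "nat \<Rightarrow> nat ugraph" where
  "star_graph n = UGraph {..<n} {{0, i} | i. 0 < i \<and> i < n}"

(* The description picks out a unique number when e has two elements, since the summand
   is symmetric in u and v; see edge_imbalance_doubleton. *)
definition edge_imbalance :: "'a ugraph \<Rightarrow> 'a set \<Rightarrow> int" where
  "edge_imbalance G e =
     (THE x. \<exists>u v. e = {u, v} \<and> x = \<bar>(int (degree G u))\<^sup>2 - (int (degree G v))\<^sup>2\<bar>)"

definition modified_albertson :: "'a ugraph \<Rightarrow> int" where
  "modified_albertson G = (\<Sum>e\<in>edges G. edge_imbalance G e)"

lemma edge_imbalance_doubleton:
  "edge_imbalance G {u, v} = \<bar>(int (degree G u))\<^sup>2 - (int (degree G v))\<^sup>2\<bar>"
  unfolding edge_imbalance_def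
  by (rule the_equality) (auto simp: doubleton_eq_iff abs_minus_commute)

lemma simple_path_graph: "simple_graph (path_graph n)"
  by (auto simp: simple_graph_def path_graph_def)

lemma simple_star_graph: "simple_graph (star_graph n)"
  by (auto simp: simple_graph_def star_graph_def)

lemma degree_star_center: "degree (star_graph n) 0 = n - 1"
proof -
  have "{e \<in> edges (star_graph n). 0 \<in> e} = (\<lambda>i. {0, i}) ` {0<..<n}"
    by (auto simp: star_graph_def)
  moreover have "inj_on (\<lambda>i. {0, i}) {0<..<n}"
    by (auto simp: inj_on_def doubleton_eq_iff)
  ultimately show ?thesis
    by (simp add: degree_def card_image)
qed

lemma degree_star_leaf:
  assumes "0 < i" and "i < n"
  shows "degree (star_graph n) i = 1"
proof -
  have "{e \<in> edges (star_graph n). i \<in> e} = {{0, i}}"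
    using assms by (auto simp: star_graph_def)
  then show ?thesis
    by (simp add: degree_def)
qed

end

theory Submission
  imports Defs
begin

text \<open>
  Upper bound. An edge whose ends have degree at most \<open>d\<close> contributes at most \<open>d\<^sup>2\<close>. In a
  star every edge contributes \<open>(n - 1)\<^sup>2 - 1 = n * (n - 2)\<close>. A tree with a vertex of degree
  \<open>n - 1\<close> is a star (\<open>isomorphic_star_graph_if_full_degree\<close>), so in \<open>T\<close> all degrees are at
  most \<open>n - 2\<close> and every edge contributes at most \<open>(n - 2)\<^sup>2 < n * (n - 2)\<close>. Since an acyclic
  graph on \<open>n\<close> vertices has at most \<open>n - 1\<close> edges (\<open>acyclic_card_edges\<close>), which is the number
  of edges of the star, the strict inequality survives summation.

  Lower bound. The path has index 6: only its two end edges contribute, \<open>2\<^sup>2 - 1\<^sup>2\<close> each. By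
  the triangle inequality, the edges along a path from \<open>u\<close> to \<open>v\<close> contribute at least the
  difference of the squared degrees of \<open>u\<close> and \<open>v\<close>
  (\<open>path_degree_gap_le_modified_albertson\<close>). A tree that is not a path contains a path from a
  vertex of degree at least 3 to a leaf (\<open>tree_branch_vertex_above_leaf\<close>), and therefore has
  index at least \<open>3\<^sup>2 - 1\<^sup>2 = 8\<close>.

  The structural facts come from a longest path. In an acyclic graph its ends have degree at
  most 1, because a further neighbour of an end would either extend the path or close a cycle.
  An edge that leaves the path cannot start at an end, as it would extend the path; so it
  starts at an interior vertex, which then has three neighbours.
\<close>

section \<open>Adjacency and degree\<close>

lemma adjacent_sym: "adjacent G u v \<longleftrightarrow> adjacent G v u"
  by (simp add: adjacent_def insert_commute)

lemma adjacent_verticesD: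
  assumes "simple_graph G" and "adjacent G u v"
  shows "u \<in> vertices G" and "v \<in> vertices G" and "u \<noteq> v"
  using assms by (fastforce simp: simple_graph_def adjacent_def)+

lemma simple_graph_edgeE:
  assumes "simple_graph G" and "e \<in> edges G"
  obtains u v where "e = {u, v}" and "u \<noteq> v" and "adjacent G u v"
  using assms by (metis adjacent_def card_2_iff simple_graph_def)

lemma finite_edges: "simple_graph G \<Longrightarrow> finite (edges G)"
  by (rule finite_subset[of _ "Pow (vertices G)"]) (auto simp: simple_graph_def)

lemma degree_eq_card_neighbours:
  assumes "simple_graph G"
  shows "degree G v = card {u. adjacent G v u}"
proof -
  have "{e \<in> edges G. v \<in> e} = (\<lambda>u. {v, u}) ` {u. adjacent G v u}"
    using simple_graph_edgeE[OF assms]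
    by (auto simp: adjacent_def image_iff) (metis insertE insert_commute singletonD)
  moreover have "inj_on (\<lambda>u. {v, u}) {u. adjacent G v u}"
    by (auto simp: inj_on_def doubleton_eq_iff)
  ultimately show ?thesis
    by (simp add: degree_def card_image)
qed

lemma neighbours_subset:
  assumes "simple_graph G"
  shows "{u. adjacent G v u} \<subseteq> vertices G - {v}"
  using adjacent_verticesD[OF assms] by blast

lemma finite_neighbours:
  assumes "simple_graph G"
  shows "finite {u. adjacent G v u}"
  using neighbours_subset[OF assms, of v] assms finite_subset
  by (fastforce simp: simple_graph_def)

lemma card_le_degree:
  assumes "simple_graph G" and "\<And>u. u \<in> A \<Longrightarrow> adjacent G v u"
  shows "card A \<le> degree G v"
  unfolding degree_eq_card_neighbours[OF assms(1)]
  using assms finite_neighbours by (intro card_mono) auto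

section \<open>Paths in acyclic graphs\<close>

definition path :: "'a ugraph \<Rightarrow> 'a list \<Rightarrow> bool" where
  "path G xs \<longleftrightarrow> walk G xs \<and> distinct xs"

definition longest_path :: "'a ugraph \<Rightarrow> 'a list \<Rightarrow> bool" where
  "longest_path G xs \<longleftrightarrow> path G xs \<and> (\<forall>ys. path G ys \<longrightarrow> length ys \<le> length xs)"

lemma path_adjacent_nth:
  "path G xs \<Longrightarrow> Suc i < length xs \<Longrightarrow> adjacent G (xs ! i) (xs ! Suc i)"
  by (simp add: path_def walk_def successively_conv_nth)

lemma walk_take_drop:
  assumes "walk G xs" and "i < length xs" and "0 < k"
  shows "walk G (take k (drop i xs))"
proof -
  have "set (take k (drop i xs)) \<subseteq> set xs"
    by (meson order_trans set_drop_subset set_take_subset)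
  with assms show ?thesis
    by (auto simp: walk_def successively_conv_nth)
qed

lemma path_take_drop:
  assumes "path G xs" and "i < length xs" and "0 < k"
  shows "path G (take k (drop i xs))"
  using assms walk_take_drop by (auto simp: path_def)

text \<open>A chord closes the segment of the path between its two ends to a cycle.\<close>

lemma path_no_chord:
  assumes "\<nexists>c. cycle G c" and "path G xs" and "Suc i < j" and "j < length xs"
  shows "\<not> adjacent G (xs ! i) (xs ! j)"
proof
  assume adj: "adjacent G (xs ! i) (xs ! j)"
  define c where "c = take (Suc (j - i)) (drop i xs)"
  have "path G c"
    unfolding c_def using assms by (intro path_take_drop) auto
  moreover have len: "length c = Suc (j - i)"
    using assms by (simp add: c_def)
  moreover have "hd c = xs ! i"
    using assms by (simp add: c_def hd_drop_conv_nth)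
  moreover have "last c = xs ! j"
    using assms len by (subst last_conv_nth) (auto simp: c_def)
  ultimately have "cycle G c"
    using adj assms(3) by (auto simp: cycle_def path_def adjacent_sym)
  with assms(1) show False by blast
qed

lemma longest_path_exists:
  assumes "simple_graph G" and "vertices G \<noteq> {}"
  obtains xs where "longest_path G xs"
proof -
  obtain v where "v \<in> vertices G" using assms(2) by blast
  then have ex: "path G [v]" by (simp add: path_def walk_def)
  have "length xs \<le> card (vertices G)" if "path G xs" for xs
    using that assms(1)
    by (metis card_mono distinct_card path_def simple_graph_def walk_def)
  then have "\<exists>xs. path G xs \<and> (\<forall>ys. path G ys \<longrightarrow> length ys \<le> length xs)"
    using ex_has_greatest_nat[of "path G" "[v]" length "Suc (card (vertices G))"] ex
    by (metis le_imp_less_Suc)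
  then show ?thesis using that by (auto simp: longest_path_def)
qed

text \<open>Reversal transfers facts about the last vertex of a longest path to its first vertex.\<close>

lemma longest_path_rev:
  assumes "longest_path G xs"
  shows "longest_path G (rev xs)"
proof -
  have "(\<lambda>u v. adjacent G v u) = adjacent G"
    by (intro ext) (rule adjacent_sym)
  then have "successively (adjacent G) (rev xs) \<longleftrightarrow> successively (adjacent G) xs"
    unfolding successively_rev by (rule arg_cong)
  with assms show ?thesis
    by (simp add: longest_path_def path_def walk_def del: successively_rev)
qed

text \<open>A neighbour of an end outside the path could be appended to it.\<close>

lemma longest_path_neighbours_last:
  assumes "simple_graph G" and "longest_path G xs" and "adjacent G (last xs) u"
  shows "u \<in> set xs"
proof (rule ccontr)
  assume "u \<notin> set xs"
  moreover have "u \<in> vertices G" using assms adjacent_verticesD by metis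
  ultimately have "path G (xs @ [u])"
    using assms by (auto simp: longest_path_def path_def walk_def successively_append_iff)
  then show False using assms(2) by (fastforce simp: longest_path_def)
qed

lemma longest_path_neighbours_hd:
  assumes "simple_graph G" and "longest_path G xs" and "adjacent G (hd xs) u"
  shows "u \<in> set xs"
  using longest_path_neighbours_last[OF assms(1) longest_path_rev[OF assms(2)]] assms
  by (simp add: last_rev longest_path_def path_def walk_def)

text \<open>
  All neighbours of the end lie on the path, and any of them other than the penultimate vertex
  would be joined to the end by a chord.
\<close>

lemma longest_path_degree_last:
  assumes "simple_graph G" and "\<nexists>c. cycle G c" and "longest_path G xs"
  shows "degree G (last xs) \<le> 1"
proof -
  let ?n = "length xs"
  have p: "path G xs" and ne: "xs \<noteq> []"
    using assms(3) by (auto simp: longest_path_def path_def walk_def)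
  have last: "last xs = xs ! (?n - 1)" using ne by (rule last_conv_nth)
  \<comment> \<open>For a path with one vertex the index \<open>?n - 2\<close> is 0; the set on the left is then empty.\<close>
  have "{u. adjacent G (last xs) u} \<subseteq> {xs ! (?n - 2)}"
  proof
    fix u assume "u \<in> {u. adjacent G (last xs) u}"
    then have adj: "adjacent G (last xs) u" by simp
    then obtain i where i: "i < ?n" "u = xs ! i"
      using longest_path_neighbours_last[OF assms(1,3)] by (metis in_set_conv_nth)
    have "i \<noteq> ?n - 1"
      using adj i last adjacent_verticesD(3)[OF assms(1)] by metis
    moreover have "\<not> Suc i < ?n - 1"
    proof
      assume "Suc i < ?n - 1"
      then have "\<not> adjacent G (xs ! i) (xs ! (?n - 1))"
        by (intro path_no_chord[OF assms(2) p]) auto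
      with adj i last show False by (simp add: adjacent_sym)
    qed
    ultimately have "i = ?n - 2" using i(1) by linarith
    then show "u \<in> {xs ! (?n - 2)}" using i by simp
  qed
  from card_mono[OF _ this] show ?thesis
    by (simp add: degree_eq_card_neighbours[OF assms(1)])
qed

text \<open>
  Deleting the end of a longest path removes one vertex and at most one edge. The induction
  runs over acyclic graphs rather than trees because acyclicity is inherited by every subgraph,
  so nothing about connectedness has to be re-established after the deletion.
\<close>

lemma acyclic_card_edges:
  assumes "simple_graph G" and "\<nexists>c. cycle G c"
  shows "card (edges G) \<le> card (vertices G) - 1"
  using assms
proof (induction "card (vertices G)" arbitrary: G)
  case 0
  then have "edges G = {}"
    by (fastforce simp: simple_graph_def)
  then show ?case by simp
next
  case (Suc n)
  then have fin: "finite (vertices G)" and ne: "vertices G \<noteq> {}"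
    by (auto simp: simple_graph_def)
  obtain xs where xs: "longest_path G xs"
    using longest_path_exists[OF Suc.prems(1) ne] .
  define v where "v = last xs"
  have v: "v \<in> vertices G"
    using xs by (auto simp: v_def longest_path_def path_def walk_def)
  have deg: "degree G v \<le> 1"
    unfolding v_def using Suc.prems xs by (rule longest_path_degree_last)
  define H where "H = UGraph (vertices G - {v}) {e \<in> edges G. v \<notin> e}"
  have H: "simple_graph H"
    using Suc.prems(1) by (auto simp: simple_graph_def H_def)
  have "walk G c" if "walk H c" for c
    using that by (auto simp: walk_def H_def adjacent_def elim: successively_mono)
  then have acyc: "\<nexists>c. cycle H c"
    using Suc.prems(2) by (auto simp: cycle_def H_def adjacent_def)
  have cV: "card (vertices H) = n" using Suc.hyps(2) v fin by (simp add: H_def)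
  have "edges G = {e \<in> edges G. v \<in> e} \<union> edges H" by (auto simp: H_def)
  then have le: "card (edges G) \<le> degree G v + card (edges H)"
    unfolding degree_def by (metis card_Un_le)
  have IH: "card (edges H) \<le> n - 1" using Suc.hyps(1)[OF cV[symmetric] H acyc] cV by simp
  show ?case
  proof (cases "n = 0")
    case True
    with H cV have "vertices G = {v}"
      using v fin Suc.hyps(2) by (metis card_1_singletonE singletonD One_nat_def)
    then have "edges G = {}"
      using Suc.prems(1) simple_graph_edgeE adjacent_verticesD
      by (metis equals0I singletonD)
    then show ?thesis by simp
  next
    case False
    with le IH deg Suc.hyps(2) show ?thesis by linarith
  qed
qed

section \<open>Recognising paths and stars\<close>

text \<open>A walk that starts in \<open>A\<close> and ends outside \<open>A\<close> leaves \<open>A\<close> at some step.\<close>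

lemma connected_boundary_edge:
  assumes "connected_graph G" and "a \<in> A" and "a \<in> vertices G"
    and "b \<in> vertices G" and "b \<notin> A"
  obtains u v where "u \<in> A" and "v \<notin> A" and "adjacent G u v"
proof -
  obtain xs where xs: "walk G xs" "hd xs = a" "last xs = b"
    using assms unfolding connected_graph_def by blast
  have "\<exists>u v. u \<in> A \<and> v \<notin> A \<and> adjacent G u v"
    if "successively (adjacent G) ys" "ys \<noteq> []" "hd ys \<in> A" "last ys \<notin> A" for ys
    using that by (induction ys rule: induct_list012) (auto split: if_splits)
  from this[of xs] xs assms that show ?thesis by (auto simp: walk_def)
qed

lemma path_graph_adjacent:
  "adjacent (path_graph n) i j \<longleftrightarrow> (j = Suc i \<and> j < n) \<or> (i = Suc j \<and> i < n)"
  by (auto simp: adjacent_def path_graph_def doubleton_eq_iff)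

text \<open>
  Consecutive vertices of the path are adjacent and no others are, since there are no chords;
  hence sending each vertex to its position is an isomorphism.
\<close>

lemma isomorphic_path_graph_if_spanning_path:
  assumes "simple_graph G" and "\<nexists>c. cycle G c" and "path G xs" and "set xs = vertices G"
  shows "isomorphic G (path_graph (card (vertices G)))"
proof -
  let ?n = "length xs"
  have d: "distinct xs" using assms(3) by (simp add: path_def)
  have n: "card (vertices G) = ?n" using d assms(4) distinct_card by metis
  have bij: "bij_betw ((!) xs) {..<?n} (vertices G)"
    using d assms(4) by (intro bij_betw_nth) auto
  have adj: "adjacent G (xs ! i) (xs ! j) \<longleftrightarrow> adjacent (path_graph ?n) i j"
    if "i < ?n" "j < ?n" for i j
  proof -
    have chord: "\<not> adjacent G (xs ! k) (xs ! l)" if "Suc k < l" "l < ?n" for k l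
      using assms(2,3) that by (rule path_no_chord)
    have succ: "adjacent G (xs ! k) (xs ! Suc k)" if "Suc k < ?n" for k
      using assms(3) that by (rule path_adjacent_nth)
    have loop: "\<not> adjacent G u u" for u
      using adjacent_verticesD(3)[OF assms(1)] by blast
    consider "Suc i < j" | "j = Suc i" | "j = i" | "i = Suc j" | "Suc j < i"
      by linarith
    then show ?thesis
      using chord[of i j] chord[of j i] succ[of i] succ[of j] loop that
      by cases (auto simp: path_graph_adjacent adjacent_sym)
  qed
  define f where "f = the_inv_into {..<?n} ((!) xs)"
  have bij_f: "bij_betw f (vertices G) {..<?n}"
    unfolding f_def using bij by (rule bij_betw_the_inv_into)
  have nth_f: "xs ! f u = u" if "u \<in> vertices G" for u
    unfolding f_def using bij that by (rule f_the_inv_into_f_bij_betw)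
  have "adjacent G u v \<longleftrightarrow> adjacent (path_graph ?n) (f u) (f v)"
    if "u \<in> vertices G" "v \<in> vertices G" for u v
    using adj[of "f u" "f v"] nth_f that bij_betwE[OF bij_f] by auto
  with bij_f show ?thesis
    unfolding isomorphic_def n by (auto simp: path_graph_def)
qed

lemma star_graph_adjacent:
  "adjacent (star_graph n) i j \<longleftrightarrow> (i = 0 \<and> 0 < j \<and> j < n) \<or> (j = 0 \<and> 0 < i \<and> i < n)"
  by (auto simp: adjacent_def star_graph_def doubleton_eq_iff)

text \<open>
  Two adjacent neighbours of \<open>c\<close> would form a triangle with it, so the spokes at \<open>c\<close> are the
  only edges. Any bijection onto \<open>{..<n}\<close> that sends \<open>c\<close> to 0 is then an isomorphism.
\<close>

lemma isomorphic_star_graph_if_full_degree: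
  assumes "simple_graph G" and "\<nexists>c. cycle G c"
    and c: "c \<in> vertices G" and "degree G c = card (vertices G) - 1"
  shows "isomorphic G (star_graph (card (vertices G)))"
proof -
  let ?V = "vertices G" and ?n = "card (vertices G)"
  have fin: "finite ?V" using assms(1) by (simp add: simple_graph_def)
  have n: "0 < ?n" using c fin card_gt_0_iff by blast
  have nbrs: "{u. adjacent G c u} = ?V - {c}"
    using assms fin neighbours_subset[OF assms(1)]
    by (intro card_subset_eq) (auto simp: degree_eq_card_neighbours[OF assms(1), symmetric])
  have spoke: "adjacent G c u \<longleftrightarrow> u \<noteq> c" if "u \<in> ?V" for u
    using nbrs that by blast
  have rim: "\<not> adjacent G u v" if "u \<in> ?V" "v \<in> ?V" "u \<noteq> c" "v \<noteq> c" for u v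
  proof
    assume "adjacent G u v"
    moreover from this have "u \<noteq> v" using adjacent_verticesD(3)[OF assms(1)] by blast
    ultimately have "cycle G [c, u, v]"
      using that c spoke adjacent_sym[of G v c] by (auto simp: cycle_def walk_def)
    with assms(2) show False by blast
  qed
  obtain g where g: "bij_betw g (?V - {c}) {0<..<?n}"
    using finite_same_card_bij[of "?V - {c}" "{0<..<?n}"] fin c by auto
  define f where "f u = (if u = c then 0 else g u)" for u
  have "bij_betw f (?V - {c}) {0<..<?n}"
    using g by (subst bij_betw_cong[of _ f g]) (auto simp: f_def)
  moreover have "bij_betw f {c} {0}" by (simp add: f_def)
  ultimately have "bij_betw f ((?V - {c}) \<union> {c}) ({0<..<?n} \<union> {0})"
    by (rule bij_betw_combine) auto
  moreover have "(?V - {c}) \<union> {c} = ?V" using c by blast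
  moreover have "{0<..<?n} \<union> {0} = {..<?n}" using n by auto
  ultimately have bij: "bij_betw f ?V {..<?n}" by simp
  have f0: "f u = 0 \<longleftrightarrow> u = c" if "u \<in> ?V" for u
    using g that by (auto simp: f_def dest: bij_betwE)
  have "adjacent G u v \<longleftrightarrow> adjacent (star_graph ?n) (f u) (f v)"
    if "u \<in> ?V" "v \<in> ?V" for u v
    using that f0[of u] f0[of v] spoke[of u] spoke[of v] rim[of u v] bij_betwE[OF bij]
    by (cases "u = c"; cases "v = c") (auto simp: star_graph_adjacent adjacent_sym)
  with bij show ?thesis
    unfolding isomorphic_def by (auto simp: star_graph_def)
qed

text \<open>
  A longest path does not span the tree, as the tree would then be a path. Connectedness gives
  an edge leaving it; it starts at an interior vertex, which has degree at least 3 since its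
  two neighbours on the path differ from the one outside. The segment from there to the end of
  the longest path is the required one.
\<close>

lemma tree_branch_vertex_above_leaf:
  assumes "tree_graph G" and "\<not> isomorphic G (path_graph (card (vertices G)))"
  obtains xs where "path G xs" and "3 \<le> degree G (hd xs)" and "degree G (last xs) \<le> 1"
proof -
  have sg: "simple_graph G" and conn: "connected_graph G" and acyc: "\<nexists>c. cycle G c"
    using assms(1) by (auto simp: tree_graph_def)
  obtain xs where xs: "longest_path G xs"
    using longest_path_exists[OF sg] conn by (auto simp: connected_graph_def)
  then have p: "path G xs" and ne: "xs \<noteq> []" and sub: "set xs \<subseteq> vertices G"
    by (auto simp: longest_path_def path_def walk_def)
  have "set xs \<noteq> vertices G"
    using isomorphic_path_graph_if_spanning_path[OF sg acyc p] assms(2) by blast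
  then obtain b where "b \<in> vertices G" "b \<notin> set xs" using sub by blast
  then obtain u v where uv: "u \<in> set xs" "v \<notin> set xs" "adjacent G u v"
    using connected_boundary_edge[OF conn, of "hd xs" "set xs" b] ne sub hd_in_set by blast
  then obtain i where i: "i < length xs" "u = xs ! i" by (metis in_set_conv_nth)
  have "u \<noteq> hd xs" using uv longest_path_neighbours_hd[OF sg xs] by blast
  then have "i \<noteq> 0" using i ne by (metis hd_conv_nth)
  then obtain k where k: "i = Suc k" using not0_implies_Suc by blast
  have "u \<noteq> last xs" using uv longest_path_neighbours_last[OF sg xs] by blast
  then have si: "Suc i < length xs" using i ne
    by (metis Suc_lessI diff_Suc_1 last_conv_nth)
  have "card {xs ! k, xs ! Suc i, v} \<le> degree G u"
    using uv i k si path_adjacent_nth[OF p, of k] path_adjacent_nth[OF p, of i]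
    by (intro card_le_degree[OF sg]) (auto simp: adjacent_sym)
  moreover have "card {xs ! k, xs ! Suc i, v} = 3"
  proof -
    have "xs ! k \<noteq> xs ! Suc i"
      using p k si by (simp add: path_def nth_eq_iff_index_eq)
    moreover have "xs ! k \<in> set xs" "xs ! Suc i \<in> set xs" using k si by auto
    ultimately have "distinct [xs ! k, xs ! Suc i, v]" using uv(2) by auto
    then show ?thesis using distinct_card by fastforce
  qed
  ultimately have "3 \<le> degree G (hd (drop i xs))"
    using i by (simp add: hd_drop_conv_nth)
  moreover have "path G (drop i xs)"
    using path_take_drop[OF p i(1), of "length xs"] ne by simp
  moreover have "degree G (last (drop i xs)) \<le> 1"
    using longest_path_degree_last[OF sg acyc xs] i(1) by (simp add: last_drop)
  ultimately show ?thesis using that by blast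
qed

section \<open>Bounds on the modified Albertson index\<close>

lemma edge_imbalance_nonneg:
  assumes "simple_graph G" and "e \<in> edges G"
  shows "0 \<le> edge_imbalance G e"
  using simple_graph_edgeE[OF assms] by (metis abs_ge_zero edge_imbalance_doubleton)

text \<open>
  The triangle inequality along the path. Summing over all edges induced on the vertices of the
  path instead of only those traversed keeps the induction simple: the edge to the new first
  vertex is not induced on the remaining ones, and additional edges only increase the sum.
\<close>

lemma path_degree_gap_le_imbalance:
  assumes "simple_graph G" and "path G xs"
  shows "\<bar>(int (degree G (hd xs)))\<^sup>2 - (int (degree G (last xs)))\<^sup>2\<bar>
         \<le> (\<Sum>e\<in>{e \<in> edges G. e \<subseteq> set xs}. edge_imbalance G e)"
  using assms(2)
proof (induction xs rule: induct_list012)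
  case 1
  then show ?case by (simp add: path_def walk_def)
next
  case (2 x)
  then show ?case using edge_imbalance_nonneg[OF assms(1)] by (auto intro: sum_nonneg)
next
  case (3 x y zs)
  let ?S = "\<lambda>xs. {e \<in> edges G. e \<subseteq> set xs}"
  have fin: "finite (?S xs)" for xs using finite_edges[OF assms(1)] by simp
  have "path G (y # zs)" and new: "{x, y} \<in> edges G" "x \<notin> set (y # zs)"
    using "3.prems" by (auto simp: path_def walk_def adjacent_def)
  then have IH: "\<bar>(int (degree G y))\<^sup>2 - (int (degree G (last (y # zs))))\<^sup>2\<bar>
      \<le> (\<Sum>e\<in>?S (y # zs). edge_imbalance G e)"
    using "3.IH"(2) by simp
  have "edge_imbalance G {x, y} + (\<Sum>e\<in>?S (y # zs). edge_imbalance G e)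
      = (\<Sum>e\<in>insert {x, y} (?S (y # zs)). edge_imbalance G e)"
    using new fin by (subst sum.insert) auto
  also have "\<dots> \<le> (\<Sum>e\<in>?S (x # y # zs). edge_imbalance G e)"
    using new fin edge_imbalance_nonneg[OF assms(1)] by (intro sum_mono2) auto
  finally show ?case using IH by (simp add: edge_imbalance_doubleton)
qed

lemma path_degree_gap_le_modified_albertson:
  assumes "simple_graph G" and "path G xs"
  shows "\<bar>(int (degree G (hd xs)))\<^sup>2 - (int (degree G (last xs)))\<^sup>2\<bar> \<le> modified_albertson G"
proof -
  have "(\<Sum>e\<in>{e \<in> edges G. e \<subseteq> set xs}. edge_imbalance G e) \<le> modified_albertson G"
    unfolding modified_albertson_def
    using finite_edges edge_imbalance_nonneg assms(1) by (intro sum_mono2) auto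
  with path_degree_gap_le_imbalance[OF assms] show ?thesis by linarith
qed

lemma modified_albertson_le:
  assumes "simple_graph G" and "\<And>v. v \<in> vertices G \<Longrightarrow> degree G v \<le> d"
  shows "modified_albertson G \<le> int (card (edges G)) * (int d)\<^sup>2"
  unfolding modified_albertson_def
proof (rule sum_bounded_above)
  fix e assume "e \<in> edges G"
  then obtain u v where e: "e = {u, v}" and "adjacent G u v"
    using simple_graph_edgeE[OF assms(1)] by metis
  then have "degree G u \<le> d" "degree G v \<le> d"
    using assms adjacent_verticesD by metis+
  then have "(int (degree G u))\<^sup>2 \<le> (int d)\<^sup>2" "(int (degree G v))\<^sup>2 \<le> (int d)\<^sup>2"
    by (simp_all add: power_mono)
  then show "edge_imbalance G e \<le> (int d)\<^sup>2"
    unfolding e edge_imbalance_doubleton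
    by (smt (verit) zero_le_power2)
qed

lemma modified_albertson_star_graph:
  assumes "2 \<le> n"
  shows "modified_albertson (star_graph n) = (int n - 1) * (int n * (int n - 2))"
proof -
  have E: "edges (star_graph n) = (\<lambda>i. {0, i}) ` {0<..<n}"
    by (auto simp: star_graph_def)
  have inj: "inj_on (\<lambda>i. {0, i}) {0<..<n}"
    by (auto simp: inj_on_def doubleton_eq_iff)
  have "edge_imbalance (star_graph n) {0, i} = int n * (int n - 2)" if "i \<in> {0<..<n}" for i
  proof -
    have "edge_imbalance (star_graph n) {0, i} = \<bar>(int n - 1)\<^sup>2 - 1\<bar>"
      using that by (simp add: edge_imbalance_doubleton degree_star_center degree_star_leaf
          of_nat_diff)
    also have "(int n - 1)\<^sup>2 - 1 = int n * (int n - 2)"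
      by (simp add: power2_eq_square algebra_simps)
    finally show ?thesis using assms by simp
  qed
  then show ?thesis
    using assms unfolding modified_albertson_def E sum.reindex[OF inj]
    by (simp add: of_nat_diff)
qed

lemma degree_path_graph:
  assumes "2 \<le> n" and "i < n"
  shows "degree (path_graph n) i = (if i = 0 \<or> Suc i = n then 1 else 2)"
proof -
  have "{j. adjacent (path_graph n) i j}
      = (if i = 0 then {1} else if Suc i = n then {i - 1} else {i - 1, Suc i})"
    using assms by (auto simp: path_graph_adjacent)
  then show ?thesis
    using assms by (auto simp: degree_eq_card_neighbours[OF simple_path_graph])
qed

lemma modified_albertson_path_graph:
  assumes "3 \<le> n"
  shows "modified_albertson (path_graph n) = 6"
proof -
  have E: "edges (path_graph n) = (\<lambda>i. {i, Suc i}) ` {..<n - 1}"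
    by (auto simp: path_graph_def)
  have inj: "inj_on (\<lambda>i. {i, Suc i}) {..<n - 1}"
    by (auto simp: inj_on_def doubleton_eq_iff)
  have imb: "edge_imbalance (path_graph n) {i, Suc i} = (if i = 0 \<or> i = n - 2 then 3 else 0)"
    if "i < n - 1" for i
    using assms that by (auto simp: edge_imbalance_doubleton degree_path_graph)
  have "modified_albertson (path_graph n) = (\<Sum>i<n - 1. if i = 0 \<or> i = n - 2 then 3 else 0)"
    unfolding modified_albertson_def E sum.reindex[OF inj] using imb by simp
  also have "\<dots> = (\<Sum>i\<in>{0, n - 2}. 3)"
    using assms by (intro sum.mono_neutral_cong_right) auto
  finally show ?thesis using assms by simp
qed

theorem proposition2p2:
  fixes T :: "'a ugraph" and n :: nat
  assumes "n \<ge> 5"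
    and "tree_graph T"
    and "card (vertices T) = n"
    and "\<not> isomorphic T (path_graph n)"
    and "\<not> isomorphic T (star_graph n)"
  shows "modified_albertson (path_graph n) < modified_albertson T \<and>
         modified_albertson T < modified_albertson (star_graph n)"
proof
  have sg: "simple_graph T" and acyc: "\<nexists>c. cycle T c"
    using assms(2) by (auto simp: tree_graph_def)
  then have fin: "finite (vertices T)" by (simp add: simple_graph_def)
  show "modified_albertson (path_graph n) < modified_albertson T"
  proof -
    obtain xs where xs: "path T xs"
      and hd: "3 \<le> degree T (hd xs)" and last: "degree T (last xs) \<le> 1"
      using tree_branch_vertex_above_leaf assms(2,3,4) by metis
    have "3\<^sup>2 \<le> (int (degree T (hd xs)))\<^sup>2" using hd by (intro power_mono) auto
    moreover have "(int (degree T (last xs)))\<^sup>2 \<le> 1\<^sup>2" using last by (intro power_mono) auto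
    ultimately have "8 \<le> modified_albertson T"
      using path_degree_gap_le_modified_albertson[OF sg xs] by simp
    with assms(1) show ?thesis by (simp add: modified_albertson_path_graph)
  qed
  show "modified_albertson T < modified_albertson (star_graph n)"
  proof -
    have "degree T v \<le> n - 2" if v: "v \<in> vertices T" for v
    proof -
      have "degree T v \<le> card (vertices T - {v})"
        unfolding degree_eq_card_neighbours[OF sg]
        using fin neighbours_subset[OF sg] by (intro card_mono) auto
      moreover have "degree T v \<noteq> n - 1"
        using isomorphic_star_graph_if_full_degree[OF sg acyc v] assms(3,5) by blast
      ultimately show ?thesis using v fin assms(3) by simp
    qed
    then have "modified_albertson T \<le> int (card (edges T)) * (int (n - 2))\<^sup>2"
      by (rule modified_albertson_le[OF sg])
    also have "\<dots> \<le> (int n - 1) * (int (n - 2))\<^sup>2"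
      using acyclic_card_edges[OF sg acyc] assms(1,3) by (intro mult_right_mono) auto
    also have "\<dots> < (int n - 1) * (int n * (int n - 2))"
      using assms(1) by (simp add: of_nat_diff power2_eq_square)
    finally show ?thesis using assms(1) by (simp add: modified_albertson_star_graph)
  qed
qed

end
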